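(* The adaptivity gap of the correlated knapsack orienteering problem (CorrKO) is $\Omega\bigl(\max\{\sqrt{\log B},\sqrt{\log\log W}\}\bigr)$, where $B$ is the travel budget and $W$ is the processing-time budget. That is, for instances with these budgets, the ratio between the optimal expected reward of an adaptive policy and the optimal expected reward of a non-adaptive policy can be as large as $\Omega\bigl(\max\{\sqrt{\log B},\sqrt{\log\log W}\}\bigr)$.
   Context: CorrKO: the input is a finite metric space $(V,d)$ with nonnegative integer distances, a root $\rho\in V$, a travel budget $B$ and a processing-time budget $W$ (positive integers). Each vertex $v\in V$ has a job with random integer size (processing time) $S_v\ge 0$ and a possibly correlated random reward $R_v\ge 0$, with explicitly given joint distribution; the pairs $(S_v,R_v)$ are independent across vertices, and $\rho$ has size and reward $0$. A policy starts at $\rho$ and visits distinct vertices one at a time; on visiting $v$ its job is processed non-preemptively and $(S_v,R_v)$ is revealed upon completion. If the policy visits $\rho=v_0,v_1,\dots,v_\ell$, then $\sum_{i=1}^{\ell} d(v_{i-1},v_i)\le B$ and $\sum_{i=1}^{\ell-1}S_{v_i}\le W$ must hold; the reward of $v_i$ is collected iff its completion time $\sum_{h\le i}S_{v_h}$ is at most $W$. The goal is to maximize expected total reward. An adaptive policy may choose the next vertex depending on the realizations observed so far; a non-adaptive policy fixes the sequence of vertices in advance (only the stopping point depends on realizations). The adaptivity gap is the supremum over instances of (optimal adaptive expected reward)/(optimal non-adaptive expected reward). Logarithms are base 2. *)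

theory Defs
  imports "HOL-Probability.Probability"
begin

text \<open>
  An instance of correlated knapsack orienteering. Every finite metric space is isometric to one
  whose points are natural numbers, so fixing the vertex type to \<^typ>\<open>nat\<close> loses no instances.
  \<open>job I v\<close> is the joint law of the pair (size, reward) of the job at \<open>v\<close>.
\<close>

record corrko =
  verts :: "nat set"
  len :: "nat \<Rightarrow> nat \<Rightarrow> nat"
  root :: nat
  travel_budget :: nat
  proc_budget :: nat
  job :: "nat \<Rightarrow> (nat \<times> real) pmf"

definition corrko_instance :: "corrko \<Rightarrow> bool" where
  "corrko_instance I \<longleftrightarrow>
     finite (verts I) \<and>
     Metric_space (verts I) (\<lambda>u v. real (len I u v)) \<and>
     root I \<in> verts I \<and>
     0 < travel_budget I \<and> 0 < proc_budget I \<and>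
     (\<forall>v\<in>verts I. finite (set_pmf (job I v)) \<and> (\<forall>(s, r)\<in>set_pmf (job I v). 0 \<le> r)) \<and>
     job I (root I) = return_pmf (0, 0)"

text \<open>
  A realization assigns to each vertex its (size, reward) pair; the pairs are independent.
\<close>

definition realizations :: "corrko \<Rightarrow> (nat \<Rightarrow> nat \<times> real) pmf" where
  "realizations I = Pi_pmf (verts I) (0, 0) (job I)"

text \<open>
  A policy is a decision tree: it stops, or visits a vertex and continues in a way that may
  depend on the (size, reward) pair observed there.
\<close>

datatype policy = Stop | Visit nat "nat \<times> real \<Rightarrow> policy"

text \<open>The vertices \<open>v\<^sub>1, \<dots>, v\<^sub>l\<close> visited after the root under a given realization.\<close>

primrec visits :: "policy \<Rightarrow> (nat \<Rightarrow> nat \<times> real) \<Rightarrow> nat list" where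
  "visits Stop \<omega> = []"
| "visits (Visit v k) \<omega> = v # visits (k (\<omega> v)) \<omega>"

text \<open>
  With 0-based list indices, \<open>(root I # vs) ! i\<close> is \<open>v\<^sub>i\<close> and \<open>vs ! i\<close> is \<open>v\<^sub>i\<^sub>+\<^sub>1\<close>. The size of the
  last job is not constrained: it may overrun the processing budget, without reward.
\<close>

definition feasible_visits :: "corrko \<Rightarrow> (nat \<Rightarrow> nat \<times> real) \<Rightarrow> nat list \<Rightarrow> bool" where
  "feasible_visits I \<omega> vs \<longleftrightarrow>
     set vs \<subseteq> verts I \<and> distinct (root I # vs) \<and>
     (\<Sum>i<length vs. len I ((root I # vs) ! i) (vs ! i)) \<le> travel_budget I \<and>
     (\<Sum>v\<leftarrow>butlast vs. fst (\<omega> v)) \<le> proc_budget I"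

definition collected :: "corrko \<Rightarrow> (nat \<Rightarrow> nat \<times> real) \<Rightarrow> nat list \<Rightarrow> real" where
  "collected I \<omega> vs =
     (\<Sum>i<length vs. if (\<Sum>h\<le>i. fst (\<omega> (vs ! h))) \<le> proc_budget I then snd (\<omega> (vs ! i)) else 0)"

definition feasible_policy :: "corrko \<Rightarrow> policy \<Rightarrow> bool" where
  "feasible_policy I \<pi> \<longleftrightarrow>
     (\<forall>\<omega>\<in>set_pmf (realizations I). feasible_visits I \<omega> (visits \<pi> \<omega>))"

definition expected_reward :: "corrko \<Rightarrow> policy \<Rightarrow> real" where
  "expected_reward I \<pi> =
     measure_pmf.expectation (realizations I) (\<lambda>\<omega>. collected I \<omega> (visits \<pi> \<omega>))"

text \<open>
  The policy visits the vertices of a fixed sequence in order; observations only influence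
  when it stops.
\<close>

primrec follows :: "policy \<Rightarrow> nat list \<Rightarrow> bool" where
  "follows Stop xs \<longleftrightarrow> True"
| "follows (Visit v k) xs \<longleftrightarrow> (\<exists>ys. xs = v # ys \<and> (\<forall>sr. follows (k sr) ys))"

definition nonadaptive :: "policy \<Rightarrow> bool" where
  "nonadaptive \<pi> \<longleftrightarrow> (\<exists>xs. follows \<pi> xs)"

text \<open>
  For \<^term>\<open>corrko_instance I\<close> the sets below are nonempty (the policy \<^term>\<open>Stop\<close>) and bounded, as
  only finitely many realizations have positive probability, so the suprema are genuine.
\<close>

definition opt_adaptive :: "corrko \<Rightarrow> real" where
  "opt_adaptive I = (SUP \<pi>\<in>{\<pi>. feasible_policy I \<pi>}. expected_reward I \<pi>)"

definition opt_nonadaptive :: "corrko \<Rightarrow> real" where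
  "opt_nonadaptive I = (SUP \<pi>\<in>{\<pi>. feasible_policy I \<pi> \<and> nonadaptive \<pi>}. expected_reward I \<pi>)"

text \<open>
  The adaptivity gap over the instances with travel budget \<open>B\<close> and processing-time budget \<open>W\<close>.
  An instance in which no policy collects any reward contributes the ratio \<open>0 / 0 = 0\<close> and hence
  does not affect the supremum.
\<close>

definition adaptivity_gap :: "nat \<Rightarrow> nat \<Rightarrow> ereal" where
  "adaptivity_gap B W =
     (SUP I\<in>{I. corrko_instance I \<and> travel_budget I = B \<and> proc_budget I = W}.
        ereal (opt_adaptive I / opt_nonadaptive I))"

end

theory Submission
  imports Defs "HOL-Library.Sublist"
begin

text \<open>
  The vertices are the nodes of a binary tree with \<open>m\<^sup>2\<close> levels in which every branch turns right at
  most \<open>m\<close> times. Edge lengths halve from level to level, so that the travel budget only permits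
  visiting nodes along one downward path. The job at a node is terminal with probability \<open>1/m\<^sup>2\<close>
  (reward 1, and nothing useful can follow), otherwise heavy with probability \<open>1/m\<close> and else of
  size 0. Reading a node as a binary number \<open>e\<close>, sizes are chosen such that a policy turning right
  exactly at the heavy jobs has consumed \<open>2\<^sup>e - 1\<close> on arrival at \<open>e\<close>; a terminal job there pays iff
  at most this much has been consumed, whereas turning left at a heavy job exceeds this amount
  forever.

  The adaptive policy collects a terminal job with probability at least \<open>1/3\<close>. A fixed
  path has at most \<open>m\<close> right turns, and after its \<open>k\<close>-th left turn is still unblocked with probability
  at most \<open>(1 - 1/m)\<^sup>k\<close>, so its expected reward is at most \<open>(m + m)/m\<^sup>2\<close>. Hence the gap is at least
  \<open>m/6\<close>, where \<open>m\<^sup>2\<close> may be as large as \<open>log B\<close> and \<open>log log W\<close>.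
\<close>

section \<open>Product distributions, geometric sums over ranks, and the turns of a path\<close>

text \<open>Overwriting coordinate \<open>x\<close> of a sample by an independent fresh draw leaves
  the product law unchanged. This conditions on a single job while the inner expectation still
  ranges over all jobs, so an induction over the tree never changes the probability space.\<close>

lemma expectation_Pi_pmf_resample:
  fixes f :: "('a \<Rightarrow> 'b) \<Rightarrow> real"
  assumes "finite A" "x \<in> A" "\<And>y. y \<in> A \<Longrightarrow> finite (set_pmf (p y))"
  shows "measure_pmf.expectation (Pi_pmf A d p) f =
    measure_pmf.expectation (p x) (\<lambda>a. measure_pmf.expectation (Pi_pmf A d p) (\<lambda>h. f (h(x := a))))"
proof -
  have fin: "finite (set_pmf (Pi_pmf A d p))"
    using assms by (auto simp: set_Pi_pmf intro!: finite_PiE_dflt)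
  have "Pi_pmf A d p = Pi_pmf (insert x (A - {x})) d p"
    using assms by (simp add: insert_absorb)
  also have "\<dots> = p x \<bind> (\<lambda>a. map_pmf (\<lambda>h. h(x := a)) (Pi_pmf A d p))"
    using assms by (subst Pi_pmf_insert')
      (auto simp: Pi_pmf_remove map_pmf_def bind_assoc_pmf bind_return_pmf)
  finally have "measure_pmf.expectation (Pi_pmf A d p) f =
      measure_pmf.expectation (p x \<bind> (\<lambda>a. map_pmf (\<lambda>h. h(x := a)) (Pi_pmf A d p))) f"
    by simp
  also have "\<dots> = (\<Sum>a\<in>set_pmf (p x). pmf (p x) a *
      measure_pmf.expectation (Pi_pmf A d p) (\<lambda>h. f (h(x := a))))"
    using assms fin by (subst pmf_expectation_bind[where A = "set_pmf (p x)"]) auto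
  also have "\<dots> = measure_pmf.expectation (p x)
      (\<lambda>a. measure_pmf.expectation (Pi_pmf A d p) (\<lambda>h. f (h(x := a))))"
    using assms by (subst integral_measure_pmf[where A = "set_pmf (p x)"]) auto
  finally show ?thesis .
qed

text \<open>By injectivity the ranks are \<open>0, ..., card A - 1\<close>, each taken once, so the
  sum is an initial part of the geometric series. Inserting elements in increasing order of
  \<open>f\<close> leaves the earlier ranks alone.\<close>

lemma sum_power_rank_le:
  fixes q :: real and f :: "'a \<Rightarrow> nat"
  assumes "finite A" "inj_on f A" "0 \<le> q" "q < 1"
  shows "(\<Sum>x\<in>A. q ^ card {y \<in> A. f y < f x}) \<le> 1 / (1 - q)"
proof -
  have "(\<Sum>x\<in>A. q ^ card {y \<in> A. f y < f x}) = (\<Sum>k<card A. q ^ k)"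
    using assms(1,2)
  proof (induction A rule: finite_ranking_induct[where f = f])
    case (insert x S)
    show ?case
    proof (cases "x \<in> S")
      case True
      with insert show ?thesis by (simp add: insert_absorb)
    next
      case False
      have less: "f y < f x" if "y \<in> S" for y
        using insert.hyps(2)[OF that] insert.prems that False
        by (metis inj_onD insertCI le_neq_implies_less)
      have 1: "{y \<in> insert x S. f y < f x} = S"
        using less by auto
      have 2: "{y \<in> insert x S. f y < f z} = {y \<in> S. f y < f z}" if "z \<in> S" for z
        using less[OF that] by auto
      show ?thesis
      proof -
        have "inj_on f S" using insert.prems by simp
        have "(\<Sum>z\<in>insert x S. q ^ card {y \<in> insert x S. f y < f z}) =
            q ^ card S + (\<Sum>z\<in>S. q ^ card {y \<in> insert x S. f y < f z})"
          by (subst sum.insert[OF insert.hyps(1) False], subst 1) (rule refl)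
        also have "(\<Sum>z\<in>S. q ^ card {y \<in> insert x S. f y < f z}) = (\<Sum>k<card S. q ^ k)"
          using insert.IH[OF \<open>inj_on f S\<close>] by (simp only: 2 cong: sum.cong)
        finally show ?thesis using insert.hyps(1) False by simp
      qed
    qed
  qed simp
  also have "\<dots> \<le> (\<Sum>k. q ^ k)"
    using assms by (intro sum_le_suminf) (auto simp: summable_geometric)
  also have "\<dots> = 1 / (1 - q)"
    using assms by (simp add: suminf_geometric)
  finally show ?thesis .
qed

text \<open>An occurrence of \<open>a\<close> in \<open>z\<close> is determined by the segment in
  front of it. With \<open>a = True\<close> this counts the right turns on the path to
  \<open>z\<close>.\<close>

lemma card_prefix_snoc: "card {x. prefix (x @ [a]) z} = count_list z a"
proof (induction z rule: rev_induct)
  case (snoc b z)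
  have "finite {x. prefix (x @ [a]) z}"
    by (rule finite_subset[of _ "set (prefixes z)"])
      (auto dest: append_prefixD)
  moreover have "{x. prefix (x @ [a]) (z @ [b])} =
      {x. prefix (x @ [a]) z} \<union> (if a = b then {z} else {})"
    by (auto simp: prefix_snoc)
  moreover have "z \<notin> {x. prefix (x @ [a]) z}"
    by (auto dest: prefix_length_le)
  ultimately show ?case using snoc by simp
qed simp

section \<open>Longest common prefixes\<close>

fun lcp_length :: "'a list \<Rightarrow> 'a list \<Rightarrow> nat" where
  "lcp_length (x # xs) (y # ys) = (if x = y then Suc (lcp_length xs ys) else 0)"
| "lcp_length _ _ = 0"

lemma lcp_length_commute: "lcp_length x y = lcp_length y x"
  by (induction x y rule: lcp_length.induct) auto

lemma lcp_length_le1: "lcp_length x y \<le> length x"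
  by (induction x y rule: lcp_length.induct) auto

lemma lcp_length_le2: "lcp_length x y \<le> length y"
  by (induction x y rule: lcp_length.induct) auto

lemma lcp_length_eq_length_iff: "lcp_length x y = length x \<longleftrightarrow> prefix x y"
  by (induction x y rule: lcp_length.induct) auto

text \<open>Serves the triangle inequality of the tree metric, where the common prefix is the lowest
  common ancestor.\<close>

lemma lcp_length_ultrametric: "min (lcp_length x y) (lcp_length y z) \<le> lcp_length x z"
proof (induction x z arbitrary: y rule: lcp_length.induct)
  case (1 a xs b zs)
  show ?case
  proof (cases y)
    case (Cons c ys)
    then show ?thesis using 1[of ys] by auto
  qed auto
qed auto

section \<open>Binary positions of nodes, and job sizes\<close>

text \<open>The number with binary digits \<open>xs\<close>, padded on the right to \<open>L\<close> digits.\<close>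

fun pos :: "nat \<Rightarrow> bool list \<Rightarrow> nat" where
  "pos L [] = 0"
| "pos L (b # xs) = of_bool b * 2 ^ (L - 1) + pos (L - 1) xs"

lemma pos_append: "pos L (xs @ ys) = pos L xs + pos (L - length xs) ys"
  by (induction xs arbitrary: L) auto

lemma pos_less: "length xs \<le> L \<Longrightarrow> pos L xs < 2 ^ L"
proof (induction xs arbitrary: L)
  case (Cons b xs)
  then obtain L' where L: "L = Suc L'" by (cases L) auto
  with Cons have "pos L' xs < 2 ^ L'" by auto
  with L show ?case by auto
qed simp

text \<open>The size of a heavy job: it raises a consumption of \<open>2 ^ pos L x - 1\<close> on
  arrival at \<open>x\<close> to the amount prescribed at the right child. If
  \<open>length x = L\<close>, the subtraction in \<open>pos\<close> truncates and the extra digit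
  has weight 1, so the size stays positive.\<close>

definition test_size :: "nat \<Rightarrow> bool list \<Rightarrow> nat" where
  "test_size L x = 2 ^ pos L (x @ [True]) - 2 ^ pos L x"

lemma pow_pos_add_test_size: "2 ^ pos L x + test_size L x = 2 ^ pos L (x @ [True])"
  by (simp add: test_size_def pos_append)

lemma test_size_pos: "0 < test_size L x"
  by (simp add: test_size_def pos_append)

text \<open>Every node \<open>x\<close> in the left subtree of \<open>y\<close> has a smaller
  position than the right child of \<open>y\<close>. So \<open>2 ^ pos L x\<close> and
  \<open>2 ^ pos L y\<close> are each at most half of \<open>2 ^ pos L (y @ [True])\<close>. This is
  why a left turn at a heavy job rules out all later terminal rewards.\<close>

lemma test_size_blocks:
  assumes "prefix (y @ [False]) x" "length x \<le> L"
  shows "2 ^ pos L x \<le> test_size L y"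
proof -
  obtain zs where x: "x = y @ [False] @ zs" using assms(1) by (auto simp: prefix_def)
  define k where "k = L - length y - 1"
  have "pos L x = pos L y + pos k zs"
    by (simp add: x pos_append k_def)
  moreover have "pos k zs < 2 ^ k"
    using assms(2) x by (intro pos_less) (auto simp: k_def)
  ultimately have "pos L x \<le> pos L y + 2 ^ k - 1" by linarith
  moreover have T: "pos L (y @ [True]) = Suc (pos L y + 2 ^ k - 1)"
    by (simp add: pos_append k_def)
  moreover have "pos L y \<le> pos L y + 2 ^ k - 1"
    using one_le_power[of "2::nat" k] by linarith
  ultimately have "(2::nat) ^ pos L x + 2 ^ pos L y \<le> 2 ^ (pos L y + 2 ^ k - 1) + 2 ^ (pos L y + 2 ^ k - 1)"
    by (intro add_mono power_increasing) auto
  also have "\<dots> = 2 ^ pos L (y @ [True])"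
    by (simp only: T power_Suc mult_2)
  finally show ?thesis
    by (simp add: test_size_def)
qed

text \<open>
  By \<open>pow_pos_le_proc\<close> below, the subtraction in the terminal size does not truncate: such a job
  completes in time iff less than \<open>2 ^ pos (m\<^sup>2) x\<close> has been consumed before.
\<close>

definition node_job :: "nat \<Rightarrow> nat \<Rightarrow> bool list \<Rightarrow> (nat \<times> real) pmf" where
  "node_job m W x =
     do { finish \<leftarrow> bernoulli_pmf (1 / (real m)^2);
          heavy \<leftarrow> bernoulli_pmf (1 / real m);
          return_pmf (if finish then (Suc W - 2 ^ pos (m^2) x, 1)
                      else if heavy then (test_size (m^2) x, 0) else (0, 0)) }"

lemma set_node_job:
  "set_pmf (node_job m W x) \<subseteq> {(Suc W - 2 ^ pos (m^2) x, 1), (test_size (m^2) x, 0), (0, 0)}"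
  by (auto simp: node_job_def split: if_splits)

lemma expectation_node_job:
  fixes f :: "nat \<times> real \<Rightarrow> real"
  assumes "0 < m"
  shows "measure_pmf.expectation (node_job m W x) f =
    1 / (real m)^2 * f (Suc W - 2 ^ pos (m^2) x, 1) +
    (1 - 1 / (real m)^2) * (1 / real m * f (test_size (m^2) x, 0) + (1 - 1 / real m) * f (0, 0))"
proof -
  have *: "measure_pmf.expectation (bernoulli_pmf p \<bind> g) f =
      p * measure_pmf.expectation (g True) f + (1 - p) * measure_pmf.expectation (g False) f"
    if "0 \<le> p" "p \<le> 1" "\<And>b. finite (set_pmf (g b))"
    for p and g :: "bool \<Rightarrow> (nat \<times> real) pmf"
    using that by (subst pmf_expectation_bind[where A = UNIV]) (auto simp: UNIV_bool)
  have "1 / real m \<le> 1" "1 / (real m)^2 \<le> 1" using assms by (auto simp: field_simps)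
  then show ?thesis
    unfolding node_job_def by (simp add: * algebra_simps)
qed

section \<open>The tree metric\<close>

text \<open>
  The first edge absorbs the part of the budget \<open>B\<close> that exceeds \<open>2 ^ L - 1\<close>.
\<close>

definition tree_depth :: "nat \<Rightarrow> nat \<Rightarrow> nat \<Rightarrow> nat" where
  "tree_depth L B j = (if j = 0 then 0 else Suc B - 2 ^ (L - j))"

text \<open>The path metric of the weighted tree, with \<open>lcp_length x y\<close> as the level of
  the lowest common ancestor.\<close>

definition tree_dist :: "nat \<Rightarrow> nat \<Rightarrow> bool list \<Rightarrow> bool list \<Rightarrow> nat" where
  "tree_dist L B x y = tree_depth L B (length x) + tree_depth L B (length y) - 2 * tree_depth L B (lcp_length x y)"

lemma tree_depth_strict_mono:
  assumes "2 ^ L \<le> Suc B" "i < j" "j \<le> L"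
  shows "tree_depth L B i < tree_depth L B j"
proof -
  have "(2::nat) ^ (L - j) < 2 ^ (L - i)" "(2::nat) ^ (L - i) \<le> 2 ^ L"
    using assms by (auto intro!: power_strict_increasing power_increasing)
  with assms(1,2) show ?thesis
    by (auto simp only: tree_depth_def split: if_splits)
qed

lemma tree_depth_mono:
  assumes "2 ^ L \<le> Suc B" "i \<le> j" "j \<le> L"
  shows "tree_depth L B i \<le> tree_depth L B j"
  using tree_depth_strict_mono[of L B i j] assms by (cases "i = j") auto

context
  fixes L B :: nat
  assumes budget: "2 ^ L \<le> Suc B"
begin

lemma tree_depth_lcp_length_le:
  assumes "length x \<le> L" "length y \<le> L"
  shows "tree_depth L B (lcp_length x y) \<le> tree_depth L B (length x)" "tree_depth L B (lcp_length x y) \<le> tree_depth L B (length y)"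
  using assms by (auto intro!: tree_depth_mono budget lcp_length_le1 lcp_length_le2)

lemma Metric_space_tree_dist:
  assumes "\<And>x. x \<in> V \<Longrightarrow> length x \<le> L"
  shows "Metric_space V (\<lambda>x y. real (tree_dist L B x y))"
proof
  fix x y show "real (tree_dist L B x y) = real (tree_dist L B y x)"
    by (simp add: tree_dist_def lcp_length_commute add.commute)
next
  fix x y assume V: "x \<in> V" "y \<in> V"
  note le = tree_depth_lcp_length_le[OF assms[OF V(1)] assms[OF V(2)]]
  show "real (tree_dist L B x y) = 0 \<longleftrightarrow> x = y"
  proof
    assume "real (tree_dist L B x y) = 0"
    with le have "tree_depth L B (lcp_length x y) = tree_depth L B (length x)"
      "tree_depth L B (lcp_length x y) = tree_depth L B (length y)" by (auto simp: tree_dist_def)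
    then have "lcp_length x y = length x" "lcp_length y x = length y"
      using tree_depth_strict_mono[OF budget, of "lcp_length x y" "length x"]
        tree_depth_strict_mono[OF budget, of "lcp_length x y" "length y"] V assms
        lcp_length_le1[of x y] lcp_length_le2[of x y]
      by (auto simp: lcp_length_commute[of y x] order_le_less)
    then show "x = y"
      by (simp add: lcp_length_eq_length_iff prefix_order.antisym)
  next
    assume "x = y"
    moreover have "lcp_length x x = length x" by (simp add: lcp_length_eq_length_iff)
    ultimately show "real (tree_dist L B x y) = 0" by (simp add: tree_dist_def)
  qed
next
  fix x y z assume V: "x \<in> V" "y \<in> V" "z \<in> V"
  note len = V[THEN assms]
  \<comment> \<open>One of the two meeting points with \<open>y\<close> is no deeper than the
    meeting point of \<open>x\<close> and \<open>z\<close>; the other is no deeper than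
    \<open>y\<close> itself. Together these bounds give the triangle inequality.\<close>
  have "tree_depth L B (min (lcp_length x y) (lcp_length y z)) \<le> tree_depth L B (lcp_length x z)"
    using lcp_length_ultrametric[of x y z] lcp_length_le1[of x z] len by (intro tree_depth_mono budget) auto
  then have "tree_depth L B (lcp_length x y) \<le> tree_depth L B (lcp_length x z) \<or> tree_depth L B (lcp_length y z) \<le> tree_depth L B (lcp_length x z)"
    by (auto simp: min_def split: if_splits)
  then have "tree_dist L B x z \<le> tree_dist L B x y + tree_dist L B y z"
    using tree_depth_lcp_length_le[OF len(1,2)] tree_depth_lcp_length_le[OF len(2,3)] tree_depth_lcp_length_le[OF len(1,3)]
    by (auto simp: tree_dist_def)
  then show "real (tree_dist L B x z) \<le> real (tree_dist L B x y) + real (tree_dist L B y z)"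
    by linarith
qed simp

lemma tree_dist_prefix:
  assumes "prefix x y" "length y \<le> L"
  shows "tree_depth L B (length x) + tree_dist L B x y = tree_depth L B (length y)"
proof -
  have "lcp_length x y = length x" using assms by (simp add: lcp_length_eq_length_iff)
  moreover have "tree_depth L B (length x) \<le> tree_depth L B (length y)"
    using assms by (intro tree_depth_mono budget prefix_length_le)
  ultimately show ?thesis by (simp add: tree_dist_def)
qed

text \<open>Having descended to level \<open>a > 0\<close>, a route has
  \<open>2 ^ (L - a) - 1\<close> of its budget left. Leaving the subtree of \<open>x\<close> means
  climbing to a level \<open>c < a\<close>, and as edge lengths halve, the climb alone costs at
  least \<open>2 ^ (L - a)\<close>.\<close>

lemma tree_dist_detour:
  assumes "x \<noteq> []" "y \<noteq> []" "length x \<le> L" "length y \<le> L" "\<not> prefix x y"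
  shows "B < tree_depth L B (length x) + tree_dist L B x y"
proof -
  define a b c where "a = length x" and "b = length y" and "c = lcp_length x y"
  have ca: "c < a"
    using assms(5) lcp_length_le1[of x y] by (auto simp: a_def c_def lcp_length_eq_length_iff[symmetric])
  have cb: "c \<le> b" by (simp add: b_def c_def lcp_length_le2)
  have ab: "0 < a" "0 < b" "a \<le> L" "b \<le> L" using assms by (auto simp: a_def b_def)
  have A: "2 * 2 ^ (L - a) \<le> (2::nat) ^ (L - c)"
  proof -
    have "2 * 2 ^ (L - a) = (2::nat) ^ Suc (L - a)" by simp
    also have "\<dots> \<le> 2 ^ (L - c)" using ca ab by (intro power_increasing) auto
    finally show ?thesis .
  qed
  have C: "(2::nat) ^ (L - c) \<le> 2 ^ L" "(2::nat) ^ (L - b) \<le> 2 ^ (L - c)"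
    using cb by (auto intro!: power_increasing)
  have add: "tree_depth L B j + 2 ^ (L - j) = Suc B" if "0 < j" for j
  proof -
    have "(2::nat) ^ (L - j) \<le> 2 ^ L" by (intro power_increasing) auto
    then have "(2::nat) ^ (L - j) \<le> Suc B" using budget by (rule order.trans)
    with that show ?thesis by (simp only: tree_depth_def) simp
  qed
  have "tree_dist L B x y + 2 * tree_depth L B c = tree_depth L B a + tree_depth L B b"
    using tree_depth_lcp_length_le[OF assms(3,4)] by (simp add: tree_dist_def a_def b_def c_def)
  \<comment> \<open>The root is an exception: its depth is set to 0, while
    \<open>Suc B - 2 ^ L\<close> may be positive.\<close>
  moreover have "tree_depth L B c = 0 \<and> c = 0 \<or> tree_depth L B c + 2 ^ (L - c) = Suc B"
    using add[of c] by (auto simp: tree_depth_def)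
  moreover have "2 * 2 ^ (L - a) \<le> Suc B"
    using A C(1) budget by linarith
  ultimately have "B < tree_depth L B a + tree_dist L B x y"
    using add[OF ab(1)] add[OF ab(2)] A C(2) by linarith
  then show ?thesis by (simp only: a_def)
qed

end


section \<open>Independence, and left turns along a chain\<close>

text \<open>Factors equal to 1 outside \<open>S\<close> extend the product to all of
  \<open>A\<close>, where independence applies.\<close>

lemma expectation_prod_Pi_pmf_subset:
  fixes f :: "'a \<Rightarrow> 'b \<Rightarrow> real"
  assumes "finite A" "S \<subseteq> A" "\<And>x. x \<in> A \<Longrightarrow> finite (set_pmf (p x))"
    and "\<And>x a. x \<in> S \<Longrightarrow> a \<in> set_pmf (p x) \<Longrightarrow> 0 \<le> f x a"
  shows "measure_pmf.expectation (Pi_pmf A d p) (\<lambda>h. \<Prod>x\<in>S. f x (h x)) =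
    (\<Prod>x\<in>S. measure_pmf.expectation (p x) (f x))"
proof -
  let ?g = "\<lambda>x a. if x \<in> S then f x a else 1"
  have "A \<inter> S = S" using assms(2) by auto
  then have *: "(\<Prod>x\<in>S. g x) = (\<Prod>x\<in>A. if x \<in> S then g x else 1)" for g :: "'a \<Rightarrow> real"
    using prod.inter_restrict[OF assms(1), of g S] by simp
  have "measure_pmf.expectation (Pi_pmf A d p) (\<lambda>h. \<Prod>x\<in>A. ?g x (h x)) =
      (\<Prod>x\<in>A. measure_pmf.expectation (p x) (?g x))"
    using assms by (intro expectation_prod_Pi_pmf integrable_measure_pmf_finite) auto
  also have "\<dots> = (\<Prod>x\<in>A. if x \<in> S then measure_pmf.expectation (p x) (f x) else 1)"
    by (intro prod.cong) auto
  finally show ?thesis by (simp only: *)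
qed

text \<open>Split \<open>C\<close> into the nodes \<open>R\<close> that the path to \<open>z\<close>
  leaves to the right and the rest \<open>N\<close>. Terms in \<open>R\<close> are at most 1 each.
  For \<open>x\<close> in \<open>N\<close>, every shorter node of \<open>N\<close> is left towards
  \<open>x\<close> by a left turn, so the exponent is at least the rank of \<open>x\<close> in
  \<open>N\<close> and the geometric bound applies.\<close>

lemma sum_power_left_turns_le:
  fixes q :: real
  assumes "finite C" "\<And>x. x \<in> C \<Longrightarrow> prefix x z" "0 \<le> q" "q < 1"
  shows "(\<Sum>x\<in>C. q ^ card {y \<in> C. prefix (y @ [False]) x}) \<le> real (count_list z True) + 1 / (1 - q)"
proof -
  define R where "R = {x \<in> C. prefix (x @ [True]) z}"
  define N where "N = C - R"
  let ?e = "\<lambda>x. q ^ card {y \<in> C. prefix (y @ [False]) x}"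
  have fin: "finite {x. prefix (x @ [True]) z}"
    by (rule finite_subset[of _ "set (prefixes z)"]) (auto dest: append_prefixD)
  have "(\<Sum>x\<in>R. ?e x) \<le> (\<Sum>x\<in>R. 1)"
    using assms by (intro sum_mono power_le_one) auto
  also have "\<dots> \<le> real (count_list z True)"
    using card_mono[OF fin, of R] by (auto simp: R_def card_prefix_snoc)
  finally have R: "(\<Sum>x\<in>R. ?e x) \<le> real (count_list z True)" .
  have sub: "{y \<in> N. length y < length x} \<subseteq> {y \<in> C. prefix (y @ [False]) x}" if "x \<in> N" for x
  proof safe
    fix y assume y: "y \<in> N" "length y < length x"
    then show "y \<in> C" by (simp add: N_def)
    have "x \<in> C" using that by (simp add: N_def)
    have "prefix y x"
      using assms(2)[OF \<open>y \<in> C\<close>] assms(2)[OF \<open>x \<in> C\<close>] less_imp_le[OF y(2)]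
      by (rule prefix_length_prefix)
    then obtain b zs where x: "x = y @ b # zs"
      using y(2) by (auto simp: prefix_def neq_Nil_conv)
    then have "prefix (y @ [b]) x" by simp
    moreover from this have "prefix (y @ [b]) z"
      using assms(2)[OF \<open>x \<in> C\<close>] by (rule prefix_order.trans)
    then have "\<not> b" using y(1) by (auto simp: N_def R_def)
    ultimately show "prefix (y @ [False]) x" by simp
  qed
  have "inj_on length N"
  proof (rule inj_onI)
    fix x y assume xy: "x \<in> N" "y \<in> N" "length x = length y"
    then have "prefix x z" "prefix y z" using assms(2) by (auto simp: N_def)
    with xy(3) have "prefix x y" "prefix y x" by (simp_all add: prefix_length_prefix[of _ z])
    then show "x = y" by (rule prefix_order.antisym)
  qed
  have "(\<Sum>x\<in>N. ?e x) \<le> (\<Sum>x\<in>N. q ^ card {y \<in> N. length y < length x})"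
    using assms sub by (intro sum_mono power_decreasing card_mono) auto
  also have "\<dots> \<le> 1 / (1 - q)"
    using assms \<open>inj_on length N\<close> by (intro sum_power_rank_le) (auto simp: N_def)
  finally have N: "(\<Sum>x\<in>N. ?e x) \<le> 1 / (1 - q)" .
  have "(\<Sum>x\<in>C. ?e x) = (\<Sum>x\<in>N. ?e x) + (\<Sum>x\<in>R. ?e x)"
    unfolding N_def by (rule sum.subset_diff) (use assms(1) in \<open>auto simp: R_def\<close>)
  with R N show ?thesis by linarith
qed

section \<open>Rewards along a path, and the policies\<close>

text \<open>A recursive form of \<open>collected\<close> in which the consumption \<open>w\<close>
  so far is a parameter, as induction along a path requires.\<close>

primrec gain :: "nat \<Rightarrow> nat \<Rightarrow> (nat \<Rightarrow> nat \<times> real) \<Rightarrow> nat list \<Rightarrow> real" where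
  "gain W w \<omega> [] = 0"
| "gain W w \<omega> (v # vs) =
     (if w + fst (\<omega> v) \<le> W then snd (\<omega> v) else 0) + gain W (w + fst (\<omega> v)) \<omega> vs"

lemma gain_eq_sum:
  "gain W w \<omega> vs =
    (\<Sum>i<length vs. if w + (\<Sum>h\<le>i. fst (\<omega> (vs ! h))) \<le> W then snd (\<omega> (vs ! i)) else 0)"
proof (induction vs arbitrary: w)
  case (Cons v vs)
  have "(\<Sum>h\<le>Suc i. fst (\<omega> ((v # vs) ! h))) = fst (\<omega> v) + (\<Sum>h\<le>i. fst (\<omega> (vs ! h)))" for i
    by (simp add: sum.atMost_Suc_shift del: sum.atMost_Suc)
  then show ?case
    by (simp add: Cons.IH sum.lessThan_Suc_shift add.assoc del: sum.lessThan_Suc sum.atMost_Suc cong: if_cong)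
qed simp

lemma collected_eq_gain: "collected I \<omega> vs = gain (proc_budget I) 0 \<omega> vs"
  by (simp add: collected_def gain_eq_sum)

lemma gain_cong:
  "(\<And>v. v \<in> set vs \<Longrightarrow> \<omega> v = \<omega>' v) \<Longrightarrow> gain W w \<omega> vs = gain W w \<omega>' vs"
  by (induction vs arbitrary: w) auto

text \<open>A nonzero reward reveals a terminal job; among the other jobs, a nonzero size reveals a
  heavy one. The test on \<open>x\<close> keeps the policy inside the tree.\<close>

primrec adapt :: "nat \<Rightarrow> nat \<Rightarrow> bool list \<Rightarrow> policy" where
  "adapt m 0 x = Stop"
| "adapt m (Suc n) x =
     (if count_list x True \<le> m
      then Visit (to_nat x) (\<lambda>(s, r). if r \<noteq> 0 then Stop else adapt m n (x @ [s \<noteq> 0]))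
      else Stop)"

text \<open>The policy started at \<open>x\<close> only inspects jobs in the subtree of
  \<open>x\<close>, so redrawing the job of an ancestor does not affect it.\<close>

lemma visits_adapt_cong:
  "(\<And>y. prefix x y \<Longrightarrow> \<omega> (to_nat y) = \<omega>' (to_nat y)) \<Longrightarrow>
   visits (adapt m n x) \<omega> = visits (adapt m n x) \<omega>'"
proof (induction n arbitrary: x)
  case (Suc n)
  have "visits (adapt m n (x @ [b])) \<omega> = visits (adapt m n (x @ [b])) \<omega>'" for b
    using Suc.prems by (intro Suc.IH) (auto dest: append_prefixD)
  moreover have "\<omega> (to_nat x) = \<omega>' (to_nat x)" using Suc.prems by simp
  ultimately show ?case by (auto split: prod.splits)
qed simp

lemma visits_adaptE:
  obtains ys where "visits (adapt m n x) \<omega> = map to_nat ys" "sorted_wrt strict_prefix ys"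
    "\<And>y. y \<in> set ys \<Longrightarrow> prefix x y \<and> length y < length x + n \<and> count_list y True \<le> m"
proof -
  have "\<exists>ys. visits (adapt m n x) \<omega> = map to_nat ys \<and> sorted_wrt strict_prefix ys \<and>
    (\<forall>y\<in>set ys. prefix x y \<and> length y < length x + n \<and> count_list y True \<le> m)"
  proof (induction n arbitrary: x)
    case (Suc n)
    show ?case
    proof (cases "count_list x True \<le> m")
      case True
      show ?thesis
      proof (cases "snd (\<omega> (to_nat x)) = 0")
        case zero: True
        define b where "b \<longleftrightarrow> fst (\<omega> (to_nat x)) \<noteq> 0"
        obtain ys where ys: "visits (adapt m n (x @ [b])) \<omega> = map to_nat ys" "sorted_wrt strict_prefix ys"
          "\<forall>y\<in>set ys. prefix (x @ [b]) y \<and> length y < length (x @ [b]) + n \<and> count_list y True \<le> m"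
          using Suc.IH by blast
        have "prefix x y \<and> strict_prefix x y \<and> length y < Suc (length x + n)" if "y \<in> set ys" for y
          using ys(3) that by (auto simp: strict_prefix_def prefix_def)
        with ys True zero show ?thesis
          by (intro exI[of _ "x # ys"]) (auto simp: b_def split: prod.splits)
      next
        case False
        with True show ?thesis
          by (intro exI[of _ "[x]"]) (auto split: prod.splits)
      qed
    qed auto
  qed auto
  then show ?thesis using that by blast
qed

lemma follows_prefix: "follows \<pi> xs \<Longrightarrow> prefix (visits \<pi> \<omega>) xs"
proof (induction \<pi> arbitrary: xs)
  case (Visit v k)
  then obtain ys where ys: "xs = v # ys" "\<forall>sr. follows (k sr) ys" by auto
  have "prefix (visits (k (\<omega> v)) \<omega>) ys"
    using ys(2) by (intro Visit.IH) blast+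
  with ys show ?case by simp
qed simp

section \<open>Routes within the travel budget, and the drift of the potential\<close>

primrec tour :: "nat \<Rightarrow> nat \<Rightarrow> bool list \<Rightarrow> bool list list \<Rightarrow> nat" where
  "tour L B a [] = 0"
| "tour L B a (x # xs) = tree_dist L B a x + tour L B x xs"

text \<open>While a route descends, the distance travelled equals the depth of its current node, so
  the first move that does not descend would overspend by \<open>tree_dist_detour\<close>.\<close>

lemma tour_imp_chain:
  assumes "2 ^ L \<le> Suc B"
  shows "\<lbrakk>tree_depth L B (length a) + tour L B a xs \<le> B; distinct (a # xs); [] \<notin> set xs;
    \<And>x. x \<in> set (a # xs) \<Longrightarrow> length x \<le> L\<rbrakk> \<Longrightarrow> sorted_wrt strict_prefix (a # xs)"
proof (induction xs arbitrary: a)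
  case (Cons y ys)
  have "prefix a y"
  proof (rule ccontr)
    assume "\<not> prefix a y"
    then have "B < tree_depth L B (length a) + tree_dist L B a y"
      using Cons.prems by (intro tree_dist_detour assms) auto
    with Cons.prems show False by simp
  qed
  moreover have "tree_depth L B (length a) + tree_dist L B a y = tree_depth L B (length y)"
    using \<open>prefix a y\<close> Cons.prems by (intro tree_dist_prefix assms) auto
  then have "sorted_wrt strict_prefix (y # ys)"
    using Cons.prems by (intro Cons.IH) auto
  moreover have "a \<noteq> y" using Cons.prems by auto
  moreover have "transp (strict_prefix :: bool list \<Rightarrow> _)"
    by (rule transpI) (rule prefix_order.less_trans)
  ultimately show ?case
    by (subst sorted_wrt2) (auto simp: strict_prefix_def)
qed simp

text \<open>Distances along a descending chain telescope to the depth of its last node, and no depth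
  exceeds \<open>B\<close>.\<close>

lemma chain_imp_tour:
  assumes "2 ^ L \<le> Suc B"
  shows "\<lbrakk>sorted_wrt strict_prefix (a # xs); \<And>x. x \<in> set (a # xs) \<Longrightarrow> length x \<le> L\<rbrakk>
    \<Longrightarrow> tree_depth L B (length a) + tour L B a xs \<le> B"
proof (induction xs arbitrary: a)
  case Nil
  have "Suc B - 2 ^ (L - length a) \<le> B"
    using one_le_power[of "2::nat" "L - length a"] by linarith
  then show ?case by (simp add: tree_depth_def)
next
  case (Cons y ys)
  have "tree_depth L B (length a) + tree_dist L B a y = tree_depth L B (length y)"
    using Cons.prems by (intro tree_dist_prefix assms) (auto simp: strict_prefix_def)
  with Cons.IH[of y] Cons.prems show ?case by simp
qed

lemma strict_prefix_chain_distinct: "sorted_wrt strict_prefix xs \<Longrightarrow> distinct xs"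
  by (induction xs) auto

text \<open>
  The induction step for \<open>expectation_adapt_ge\<close>: the potential \<open>\<Phi>\<close> drops by 1 per level
  and by \<open>M\<close> more with probability \<open>p = 1/M\<close>, that is by about 2 in expectation.
\<close>

lemma drift_step:
  fixes a b p M \<Phi> \<epsilon> :: real
  assumes p: "p * M = 1" "0 \<le> p" "p \<le> 1" and \<epsilon>: "0 \<le> \<epsilon>" "\<epsilon> \<le> 1" "\<epsilon> * \<Phi> \<le> 1"
    and a: "(\<Phi> - M) * (\<epsilon> / 3) \<le> a" and b: "\<Phi> * (\<epsilon> / 3) \<le> b"
  shows "(\<Phi> + 1) * (\<epsilon> / 3) \<le> \<epsilon> + (1 - \<epsilon>) * (p * a + (1 - p) * b)"
proof -
  define k where "k = \<epsilon> / 3"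
  have k: "\<epsilon> = 3 * k" "0 \<le> k" using \<epsilon> by (auto simp: k_def)
  have "p * ((\<Phi> - M) * k) + (1 - p) * (\<Phi> * k) = (\<Phi> - p * M) * k"
    by (simp add: algebra_simps)
  then have eq: "p * ((\<Phi> - M) * k) + (1 - p) * (\<Phi> * k) = (\<Phi> - 1) * k"
    by (simp only: p)
  \<comment> \<open>Origin of the constant 3: the immediate reward \<open>\<epsilon> = 3 * k\<close>
    pays \<open>2 * k\<close> for the drift from \<open>\<Phi> + 1\<close> to
    \<open>\<Phi> - 1\<close>, and at most \<open>k\<close> for the continuation lost by
    termination, since \<open>\<epsilon> * \<Phi> \<le> 1\<close>.\<close>
  have "0 \<le> (1 - \<epsilon> * \<Phi> + \<epsilon>) * k"
    using \<epsilon> k by (intro mult_nonneg_nonneg) auto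
  also have "\<dots> = 3 * k + (1 - \<epsilon>) * ((\<Phi> - 1) * k) - (\<Phi> + 1) * k"
    by (simp add: algebra_simps)
  finally have "(\<Phi> + 1) * k \<le> \<epsilon> + (1 - \<epsilon>) * ((\<Phi> - 1) * k)"
    using k(1) by linarith
  also have "\<dots> \<le> \<epsilon> + (1 - \<epsilon>) * (p * a + (1 - p) * b)"
    unfolding eq[symmetric] using p \<epsilon> a b by (intro add_mono mult_left_mono order_refl) (auto simp: k_def)
  finally show ?thesis by (simp only: k_def)
qed

section \<open>The instance\<close>

text \<open>\<open>travel\<close> makes room for \<open>m^2\<close> levels of halving edges,
  \<open>proc\<close> for the powers of 2 at all positions, which stay below
  \<open>2 ^ m^2\<close>.\<close>

locale gap_instance =
  fixes m B W :: nat
  assumes m_pos: "0 < m" and travel: "2 ^ m^2 \<le> Suc B" and proc: "2 ^ 2 ^ m^2 \<le> W"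
begin

definition nodes :: "bool list set" where
  "nodes = {x. length x \<le> m^2 \<and> count_list x True \<le> m}"

definition inst :: corrko where
  "inst = \<lparr>verts = to_nat ` nodes, len = (\<lambda>u v. tree_dist (m^2) B (from_nat u) (from_nat v)),
    root = to_nat ([] :: bool list), travel_budget = B, proc_budget = W,
    job = (\<lambda>v. if v = to_nat ([] :: bool list) then return_pmf (0, 0) else node_job m W (from_nat v))\<rparr>"

lemma inst_simps [simp]:
  "verts inst = to_nat ` nodes"
  "len inst (to_nat x) (to_nat y) = tree_dist (m^2) B x y"
  "root inst = to_nat ([] :: bool list)"
  "travel_budget inst = B"
  "proc_budget inst = W"
  by (simp_all add: inst_def)

lemma job_inst: "x \<noteq> [] \<Longrightarrow> job inst (to_nat x) = node_job m W x"
  by (simp add: inst_def)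

lemma job_root: "job inst (to_nat ([] :: bool list)) = return_pmf (0, 0)"
  by (simp add: inst_def)

lemma finite_nodes: "finite nodes"
proof (rule finite_subset)
  show "nodes \<subseteq> {xs. set xs \<subseteq> UNIV \<and> length xs \<le> m^2}" by (auto simp: nodes_def)
  show "finite {xs. set xs \<subseteq> (UNIV :: bool set) \<and> length xs \<le> m^2}"
    by (rule finite_lists_length_le) simp
qed

lemma finite_set_job: "finite (set_pmf (job inst (to_nat (x :: bool list))))"
  by (cases "x = []") (auto simp: job_root job_inst intro: finite_subset[OF set_node_job])

lemma proc_pos: "0 < W"
  using proc one_le_power[of "2::nat" "2 ^ m^2"] by linarith

lemma travel_pos: "0 < B"
proof -
  have "(2::nat) ^ 1 \<le> 2 ^ m^2" using m_pos by (intro power_increasing) auto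
  with travel show ?thesis by simp
qed

lemma corrko_instance_inst: "corrko_instance inst"
proof -
  have "Metric_space nodes (\<lambda>x y. real (tree_dist (m^2) B x y))"
    by (rule Metric_space_tree_dist[OF travel]) (simp add: nodes_def)
  then have "Metric_space (to_nat ` nodes) (\<lambda>u v. real (len inst u v))"
    unfolding Metric_space_def by (auto simp: inst_def)
  moreover have "0 \<le> r" if "(s, r) \<in> set_pmf (job inst (to_nat x))" for s r and x :: "bool list"
    using that set_node_job[of m W x] by (cases "x = []") (auto simp: job_root job_inst)
  ultimately show ?thesis
    using finite_nodes finite_set_job proc_pos travel_pos
    by (auto simp: corrko_instance_def job_root) (simp_all add: nodes_def)
qed

lemma pow_pos_le_proc: "length x \<le> m^2 \<Longrightarrow> 2 ^ pos (m^2) x \<le> W"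
  using pos_less[of x "m^2"] proc
  by (intro order.trans[OF power_increasing proc]) auto

lemma finite_realizations: "finite (set_pmf (realizations inst))"
  using finite_nodes finite_set_job
  by (auto simp: realizations_def set_Pi_pmf intro!: finite_PiE_dflt)

lemma realization_cases:
  assumes "\<omega> \<in> set_pmf (realizations inst)" "x \<in> nodes" "x \<noteq> []"
  shows "\<omega> (to_nat x) \<in> {(Suc W - 2 ^ pos (m^2) x, 1), (test_size (m^2) x, 0), (0, 0)}"
proof -
  have "\<omega> (to_nat x) \<in> set_pmf (job inst (to_nat x))"
    using assms finite_nodes by (auto simp: realizations_def set_Pi_pmf PiE_dflt_def)
  with assms set_node_job[of m W x] show ?thesis by (auto simp: job_inst)
qed

lemma expectation_resample:
  fixes f :: "(nat \<Rightarrow> nat \<times> real) \<Rightarrow> real"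
  assumes "x \<in> nodes" "x \<noteq> []"
  shows "measure_pmf.expectation (realizations inst) f =
    1 / (real m)^2 * measure_pmf.expectation (realizations inst)
      (\<lambda>h. f (h(to_nat x := (Suc W - 2 ^ pos (m^2) x, 1)))) +
    (1 - 1 / (real m)^2) *
      (1 / real m * measure_pmf.expectation (realizations inst)
        (\<lambda>h. f (h(to_nat x := (test_size (m^2) x, 0)))) +
       (1 - 1 / real m) * measure_pmf.expectation (realizations inst)
        (\<lambda>h. f (h(to_nat x := (0, 0)))))"
  using assms finite_nodes finite_set_job m_pos unfolding realizations_def
  by (subst expectation_Pi_pmf_resample[where x = "to_nat x"])
     (auto simp: job_inst expectation_node_job)

lemma tour_eq:
  "(\<Sum>i<length xs. len inst ((to_nat a # map to_nat xs) ! i) (map to_nat xs ! i)) = tour (m^2) B a xs"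
proof (induction xs arbitrary: a)
  case (Cons x xs)
  from Cons.IH[of x] show ?case
    by (simp add: sum.lessThan_Suc_shift del: sum.lessThan_Suc)
qed simp

text \<open>\<open>tour_imp_chain\<close> applied from the root, where the distance travelled is 0:
  the travel budget alone forces any feasible route to descend.\<close>

lemma feasible_visitsE:
  assumes "feasible_visits inst \<omega> vs"
  obtains xs where "vs = map to_nat xs" "set xs \<subseteq> nodes - {[]}" "sorted_wrt strict_prefix xs"
proof
  define xs where "xs = map (from_nat :: nat \<Rightarrow> bool list) vs"
  have sub: "set vs \<subseteq> to_nat ` nodes" using assms by (simp add: feasible_visits_def)
  then show vs: "vs = map to_nat xs"
    by (auto simp: xs_def intro!: map_idI[symmetric])
  have d: "distinct ([] # xs)"
    using assms by (auto simp: feasible_visits_def vs distinct_map)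
  show "set xs \<subseteq> nodes - {[]}"
    using sub d by (auto simp: vs)
  have "tour (m^2) B [] xs \<le> B"
    using assms tour_eq[of "[]" xs] by (simp add: feasible_visits_def vs)
  then have "sorted_wrt strict_prefix ([] # xs)"
    using d \<open>set xs \<subseteq> nodes - {[]}\<close>
    by (intro tour_imp_chain[OF travel]) (auto simp: nodes_def tree_depth_def)
  then show "sorted_wrt strict_prefix xs" by simp
qed

section \<open>Feasibility and reward of the adaptive policy\<close>

text \<open>A light or heavy job at a node turns \<open>2 ^ pos\<close> of that node into exactly
  \<open>2 ^ pos\<close> of the next one. A terminal job ends the visits, so \<open>butlast\<close>
  drops its size, and the total is \<open>2 ^ pos\<close> of the last node visited.\<close>

lemma sizes_adapt:
  assumes "\<omega> \<in> set_pmf (realizations inst)"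
  shows "\<lbrakk>length x + n = Suc (m^2); x \<noteq> []; visits (adapt m n x) \<omega> \<noteq> []\<rbrakk> \<Longrightarrow>
    2 ^ pos (m^2) x + (\<Sum>v\<leftarrow>butlast (visits (adapt m n x) \<omega>). fst (\<omega> v)) \<le> W"
proof (induction n arbitrary: x)
  case (Suc n)
  have x: "x \<in> nodes" using Suc.prems by (auto simp: nodes_def split: if_splits)
  define b where "b \<longleftrightarrow> fst (\<omega> (to_nat x)) \<noteq> 0"
  have le: "2 ^ pos (m^2) x \<le> W" using x by (intro pow_pos_le_proc) (simp add: nodes_def)
  have v: "visits (adapt m (Suc n) x) \<omega> =
      to_nat x # (if snd (\<omega> (to_nat x)) \<noteq> 0 then [] else visits (adapt m n (x @ [b])) \<omega>)"
    using x by (auto simp: nodes_def b_def split: prod.splits)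
  show ?case
  proof (cases "snd (\<omega> (to_nat x)) \<noteq> 0 \<or> visits (adapt m n (x @ [b])) \<omega> = []")
    case True
    then show ?thesis using le by (auto simp: v simp del: adapt.simps)
  next
    case False
    have "2 ^ pos (m^2) x + fst (\<omega> (to_nat x)) = 2 ^ pos (m^2) (x @ [b])"
      using realization_cases[OF assms x Suc.prems(2)] False pow_pos_add_test_size[of "m^2" x]
        test_size_pos[of "m^2" x]
      by (auto simp: b_def pos_append)
    with False Suc.IH[of "x @ [b]"] Suc.prems(1) show ?thesis by (simp add: v del: adapt.simps)
  qed
qed simp

lemma feasible_adapt: "feasible_policy inst (adapt m (m^2) [False])"
  unfolding feasible_policy_def
proof
  fix \<omega> assume w: "\<omega> \<in> set_pmf (realizations inst)"
  obtain ys where ys: "visits (adapt m (m^2) [False]) \<omega> = map to_nat ys" "sorted_wrt strict_prefix ys"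
    "\<And>y. y \<in> set ys \<Longrightarrow> prefix [False] y \<and> length y < length [False] + m^2 \<and> count_list y True \<le> m"
    using visits_adaptE by metis
  have sub: "set ys \<subseteq> nodes - {[]}" using ys(3) by (fastforce simp: nodes_def)
  then have chain: "sorted_wrt strict_prefix ([] # ys)"
    using ys(2) by (auto simp: strict_prefix_def)
  then have "distinct ([] # ys)"
    by (rule strict_prefix_chain_distinct)
  have "tour (m^2) B [] ys \<le> B"
    using chain_imp_tour[OF travel chain] sub by (force simp: nodes_def tree_depth_def)
  moreover have "(\<Sum>v\<leftarrow>butlast (visits (adapt m (m^2) [False]) \<omega>). fst (\<omega> v)) \<le> W"
    using sizes_adapt[OF w, of "[False]" "m^2"] by (cases "visits (adapt m (m^2) [False]) \<omega> = []") auto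
  moreover have "distinct (to_nat ([] :: bool list) # map to_nat ys)"
    using \<open>distinct ([] # ys)\<close> by (auto simp: distinct_map)
  ultimately show "feasible_visits inst \<omega> (visits (adapt m (m^2) [False]) \<omega>)"
    using sub tour_eq[of "[]" ys] by (auto simp: feasible_visits_def ys(1))
qed

text \<open>The numerator is a potential: levels left minus \<open>m\<close> per right turn made.
  Redrawing the job at \<open>x\<close> yields reward 1, the right child or the left child, and
  \<open>drift_step\<close> combines the three cases.\<close>

lemma expectation_adapt_ge:
  "\<lbrakk>length x + n = Suc (m^2); x \<noteq> []\<rbrakk> \<Longrightarrow>
    (real n - real m * real (count_list x True)) / (3 * (real m)^2) \<le>
    measure_pmf.expectation (realizations inst)
      (\<lambda>\<omega>. gain W (2 ^ pos (m^2) x - 1) \<omega> (visits (adapt m n x) \<omega>))"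
proof (induction n arbitrary: x)
  case 0
  then show ?case by (auto intro!: divide_nonpos_nonneg)
next
  case (Suc n)
  show ?case
  proof (cases "count_list x True \<le> m")
    case False
    \<comment> \<open>Beyond \<open>m\<close> right turns the policy stops, and the potential is
      already nonpositive since at most \<open>m^2\<close> levels remain.\<close>
    have "n < m^2" using Suc.prems by (cases x) auto
    then have "Suc n \<le> m * Suc m" by (auto simp: power2_eq_square)
    also have "\<dots> \<le> m * count_list x True" using False by (intro mult_le_mono) auto
    finally have "real (Suc n) \<le> real m * real (count_list x True)"
      by (metis of_nat_le_iff of_nat_mult)
    with False show ?thesis by (auto intro!: divide_nonpos_nonneg)
  next
    case True
    have x: "x \<in> nodes" using True Suc.prems by (auto simp: nodes_def)
    have le: "2 ^ pos (m^2) x \<le> W" using x by (intro pow_pos_le_proc) (simp add: nodes_def)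
    let ?E = "measure_pmf.expectation (realizations inst)"
    let ?F = "\<lambda>n x \<omega>. gain W (2 ^ pos (m^2) x - 1) \<omega> (visits (adapt m n x) \<omega>)"
    \<comment> \<open>The continuation below \<open>x\<close> never returns to \<open>x\<close>, so
      the overwritten value can be removed.\<close>
    have upd: "gain W w (h(to_nat x := a)) (visits (adapt m n (x @ [b])) (h(to_nat x := a))) =
        gain W w h (visits (adapt m n (x @ [b])) h)" for h w a b
    proof -
      have "visits (adapt m n (x @ [b])) (h(to_nat x := a)) = visits (adapt m n (x @ [b])) h"
        by (rule visits_adapt_cong) (auto simp: prefix_def)
      moreover obtain ys where "visits (adapt m n (x @ [b])) h = map to_nat ys"
        "\<And>y. y \<in> set ys \<Longrightarrow> prefix (x @ [b]) y"
        using visits_adaptE by metis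
      moreover from this have "x \<notin> set ys" by fastforce
      ultimately show ?thesis by (auto intro!: gain_cong)
    qed
    \<comment> \<open>The terminal job completes exactly at \<open>W\<close>.\<close>
    have finish: "?F (Suc n) x (h(to_nat x := (Suc W - 2 ^ pos (m^2) x, 1))) = 1" for h
      using True le by simp
    have heavy: "?F (Suc n) x (h(to_nat x := (test_size (m^2) x, 0))) = ?F n (x @ [True]) h" for h
      using True test_size_pos[of "m^2" x] pow_pos_add_test_size[of "m^2" x, symmetric]
      by (simp add: upd)
    have light: "?F (Suc n) x (h(to_nat x := (0, 0))) = ?F n (x @ [False]) h" for h
      using True by (simp add: upd pos_append)
    define c where "c = real (count_list x True)"
    define \<epsilon> where "\<epsilon> = 1 / (real m)^2"
    define p where "p = 1 / real m"
    define \<Phi> where "\<Phi> = real n - real m * c"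
    have pm: "p * real m = 1" "0 \<le> p" "p \<le> 1" "0 < \<epsilon>" "\<epsilon> \<le> 1"
      using m_pos by (auto simp: p_def \<epsilon>_def field_simps)
    have T: "(\<Phi> - real m) * (\<epsilon> / 3) \<le> ?E (?F n (x @ [True]))"
    proof -
      have "(\<Phi> - real m) * (\<epsilon> / 3) =
          (real n - real m * real (count_list (x @ [True]) True)) / (3 * (real m)^2)"
        using m_pos by (simp add: \<Phi>_def c_def \<epsilon>_def field_simps)
      also have "\<dots> \<le> ?E (?F n (x @ [True]))"
        using Suc.prems by (intro Suc.IH) auto
      finally show ?thesis .
    qed
    have F: "\<Phi> * (\<epsilon> / 3) \<le> ?E (?F n (x @ [False]))"
      using Suc.IH[of "x @ [False]"] Suc.prems by (simp add: \<Phi>_def c_def \<epsilon>_def algebra_simps)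
    have "n \<le> m^2" using Suc.prems by (cases x) auto
    then have "real n \<le> (real m)^2" by (metis of_nat_le_iff of_nat_power)
    moreover have "0 \<le> real m * c" by (simp add: c_def)
    ultimately have "\<Phi> \<le> (real m)^2" unfolding \<Phi>_def by linarith
    then have \<Phi>: "\<epsilon> * \<Phi> \<le> 1" using m_pos by (simp add: \<epsilon>_def field_simps)
    have "(real (Suc n) - real m * real (count_list x True)) / (3 * (real m)^2) = (\<Phi> + 1) * (\<epsilon> / 3)"
      by (simp add: \<Phi>_def c_def \<epsilon>_def ac_simps)
    also have "\<dots> \<le> \<epsilon> + (1 - \<epsilon>) * (p * ?E (?F n (x @ [True])) + (1 - p) * ?E (?F n (x @ [False])))"
      using pm \<Phi> T F by (intro drift_step[where M = "real m"]) auto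
    also have "\<dots> = ?E (?F (Suc n) x)"
      unfolding expectation_resample[OF x Suc.prems(2), of "?F (Suc n) x"] finish heavy light p_def \<epsilon>_def
      by simp
    finally show ?thesis .
  qed
qed

text \<open>A crude bound independent of the policy, which makes the suprema bounded above.\<close>

lemma collected_le_card:
  assumes "\<omega> \<in> set_pmf (realizations inst)" "feasible_visits inst \<omega> vs"
  shows "collected inst \<omega> vs \<le> real (card nodes)"
proof -
  obtain xs where xs: "vs = map to_nat xs" "set xs \<subseteq> nodes - {[]}" "sorted_wrt strict_prefix xs"
    using assms(2) by (rule feasible_visitsE)
  have r: "snd (\<omega> (vs ! i)) \<le> 1" if "i < length vs" for i
  proof -
    have "xs ! i \<in> nodes - {[]}" using that xs by (auto dest: nth_mem)
    with realization_cases[OF assms(1), of "xs ! i"] that show ?thesis by (auto simp: xs(1))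
  qed
  have "collected inst \<omega> vs \<le> (\<Sum>i<length vs. 1)"
    unfolding collected_def using r by (intro sum_mono) auto
  also have "length vs = card (set xs)"
    using strict_prefix_chain_distinct[OF xs(3)] by (simp add: xs(1) distinct_card)
  also have "\<dots> \<le> card nodes"
    using xs(2) finite_nodes by (intro card_mono) auto
  finally show "collected inst \<omega> vs \<le> real (card nodes)" by simp
qed

lemma expected_reward_le_card:
  assumes "feasible_policy inst \<pi>"
  shows "expected_reward inst \<pi> \<le> real (card nodes)"
  unfolding expected_reward_def using assms
  by (intro measure_pmf.integral_le_const integrable_measure_pmf_finite finite_realizations)
     (auto simp: AE_measure_pmf_iff feasible_policy_def intro: collected_le_card)

lemma bdd_above_expected_reward:
  "A \<subseteq> {\<pi>. feasible_policy inst \<pi>} \<Longrightarrow> bdd_above (expected_reward inst ` A)"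
  by (rule bdd_aboveI2[where M = "real (card nodes)"]) (auto intro: expected_reward_le_card)

text \<open>At \<open>[False]\<close> the position is 0, so the consumption is
  \<open>2 ^ 0 - 1 = 0\<close>; with \<open>m^2\<close> levels left and no right turns made, the
  potential bound equals \<open>1 / 3\<close>.\<close>

lemma opt_adaptive_ge: "1 / 3 \<le> opt_adaptive inst"
proof -
  have "1 / 3 \<le> expected_reward inst (adapt m (m^2) [False])"
    using expectation_adapt_ge[of "[False]" "m^2"] m_pos
    by (simp add: expected_reward_def collected_eq_gain power2_eq_square)
  also have "\<dots> \<le> opt_adaptive inst"
    unfolding opt_adaptive_def using feasible_adapt
    by (intro cSUP_upper bdd_above_expected_reward) auto
  finally show ?thesis .
qed


section \<open>The upper bound for nonadaptive policies\<close>

text \<open>The product indicates that no node left by a left turn before \<open>x\<close> has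
  blocked the path. If the terminal job at \<open>x\<close> pays, less than
  \<open>2 ^ pos (m^2) x\<close> was consumed before, which by \<open>test_size_blocks\<close>
  excludes a size of \<open>test_size\<close> or more at such a node. The cut at \<open>k\<close>
  allows for early stopping.\<close>

lemma collected_chain_le:
  assumes w: "\<omega> \<in> set_pmf (realizations inst)"
    and xs: "set xs \<subseteq> nodes - {[]}" "sorted_wrt strict_prefix xs"
  shows "collected inst \<omega> (take k (map to_nat xs)) \<le>
    (\<Sum>x\<in>set xs. snd (\<omega> (to_nat x)) *
      (\<Prod>y | y \<in> set xs \<and> prefix (y @ [False]) x. of_bool (fst (\<omega> (to_nat y)) < test_size (m^2) y)))"
    (is "_ \<le> (\<Sum>x\<in>set xs. ?g x)")
proof -
  have cases: "\<omega> (to_nat (xs ! i)) \<in>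
      {(Suc W - 2 ^ pos (m^2) (xs ! i), 1), (test_size (m^2) (xs ! i), 0), (0, 0)}"
    if "i < length xs" for i
  proof -
    have "xs ! i \<in> nodes - {[]}" using that xs(1) by (meson nth_mem subsetD)
    then show ?thesis using realization_cases[OF w] by blast
  qed
  have nonneg: "0 \<le> ?g (xs ! i)" if "i < length xs" for i
    using cases[OF that] by (intro mult_nonneg_nonneg prod_nonneg) auto
  have "collected inst \<omega> (take k (map to_nat xs)) =
      (\<Sum>i<min k (length xs). if (\<Sum>h\<le>i. fst (\<omega> (to_nat (xs ! h)))) \<le> W
        then snd (\<omega> (to_nat (xs ! i))) else 0)"
    unfolding collected_def by (intro sum.cong if_cong) (auto simp: min.commute)
  also have "\<dots> \<le> (\<Sum>i<min k (length xs). ?g (xs ! i))"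
  proof (intro sum_mono)
    fix i assume "i \<in> {..<min k (length xs)}"
    then have i: "i < length xs" by simp
    show "(if (\<Sum>h\<le>i. fst (\<omega> (to_nat (xs ! h)))) \<le> W then snd (\<omega> (to_nat (xs ! i))) else 0) \<le> ?g (xs ! i)"
    proof (cases "(\<Sum>h\<le>i. fst (\<omega> (to_nat (xs ! h)))) \<le> W \<and> snd (\<omega> (to_nat (xs ! i))) \<noteq> 0")
      case False
      then show ?thesis using nonneg[OF i] by auto
    next
      case True
      have len: "length (xs ! i) \<le> m^2" using xs(1) nth_mem[OF i] by (auto simp: nodes_def)
      have eq: "\<omega> (to_nat (xs ! i)) = (Suc W - 2 ^ pos (m^2) (xs ! i), 1)"
        using cases[OF i] True by auto
      have "(\<Sum>h\<le>i. fst (\<omega> (to_nat (xs ! h)))) =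
          (\<Sum>h<i. fst (\<omega> (to_nat (xs ! h)))) + (Suc W - 2 ^ pos (m^2) (xs ! i))"
        using eq by (simp add: lessThan_Suc_atMost[symmetric])
      then have less: "(\<Sum>h<i. fst (\<omega> (to_nat (xs ! h)))) < 2 ^ pos (m^2) (xs ! i)"
        using True pow_pos_le_proc[OF len] by linarith
      have "fst (\<omega> (to_nat y)) < test_size (m^2) y"
        if y: "y \<in> set xs" "prefix (y @ [False]) (xs ! i)" for y
      proof -
        obtain h where h: "h < length xs" "y = xs ! h" using y(1) by (auto simp: in_set_conv_nth)
        have "h < i"
        proof (rule ccontr)
          assume "\<not> h < i"
          then have "prefix (xs ! i) y"
            using sorted_wrt_nth_less[OF xs(2), of i h] h
            by (cases "h = i") (auto simp: strict_prefix_def)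
          with y(2) show False by (auto dest!: prefix_length_le)
        qed
        then have "fst (\<omega> (to_nat y)) \<le> (\<Sum>h<i. fst (\<omega> (to_nat (xs ! h))))"
          unfolding h(2) by (intro member_le_sum) auto
        with less test_size_blocks[OF y(2) len] show ?thesis by linarith
      qed
      then have "(\<Prod>y | y \<in> set xs \<and> prefix (y @ [False]) (xs ! i).
          of_bool (fst (\<omega> (to_nat y)) < test_size (m^2) y) :: real) = 1"
        by (intro prod.neutral) auto
      then show ?thesis using eq by simp
    qed
  qed
  also have "\<dots> \<le> (\<Sum>i<length xs. ?g (xs ! i))"
    using nonneg by (intro sum_mono2) auto
  also have "\<dots> = (\<Sum>x\<in>set xs. ?g x)"
    using bij_betw_nth[OF strict_prefix_chain_distinct[OF xs(2)] refl refl]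
    by (intro sum.reindex_bij_betw)
  finally show ?thesis .
qed

text \<open>By independence the expectation factors: the mean reward at \<open>x\<close> is
  \<open>1/m^2\<close>, and each \<open>y\<close> is unblocked only if its job is light, with
  probability \<open>(1 - 1/m^2) * (1 - 1/m)\<close>.\<close>

lemma expectation_unblocked_le:
  assumes x: "x \<in> nodes - {[]}" and Y: "Y \<subseteq> nodes - {[]}" "x \<notin> Y"
  shows "measure_pmf.expectation (realizations inst)
      (\<lambda>\<omega>. snd (\<omega> (to_nat x)) * (\<Prod>y\<in>Y. of_bool (fst (\<omega> (to_nat y)) < test_size (m^2) y))) \<le>
    1 / (real m)^2 * (1 - 1 / real m) ^ card Y"
proof -
  \<comment> \<open>One family of factors covers both the reward at \<open>x\<close> and the
    indicators on \<open>Y\<close>.\<close>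
  define f :: "nat \<Rightarrow> nat \<times> real \<Rightarrow> real" where
    "f = (\<lambda>v a. if v = to_nat x then snd a else of_bool (fst a < test_size (m^2) (from_nat v)))"
  have fin: "finite Y" using Y(1) finite_nodes by (metis finite_Diff finite_subset)
  have split: "(\<Prod>v\<in>to_nat ` insert x Y. g v) = g (to_nat x) * (\<Prod>y\<in>Y. g (to_nat y))" for g :: "nat \<Rightarrow> real"
    using fin Y(2) by (subst prod.reindex) auto
  have p: "0 \<le> 1 - 1 / real m" "0 \<le> 1 - 1 / (real m)^2" "1 / (real m)^2 \<ge> 0"
    using m_pos by (auto simp: field_simps)
  have job: "measure_pmf.expectation (job inst (to_nat y)) (f (to_nat y)) \<le> 1 - 1 / real m"
    if "y \<in> Y" for y
  proof -
    have "y \<noteq> []" "y \<noteq> x" "y \<in> nodes" using that Y by auto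
    have "pos (m^2) y < 2 ^ m^2"
      using \<open>y \<in> nodes\<close> by (intro pos_less) (simp add: nodes_def)
    have "pos (m^2) (y @ [True]) \<le> 2 ^ m^2"
    \<comment> \<open>At a deepest node the appended digit adds 1, which the strict bound on
      \<open>pos (m^2) y\<close> absorbs.\<close>
    proof (cases "length y = m^2")
      case True
      with \<open>pos (m^2) y < 2 ^ m^2\<close> show ?thesis by (simp add: pos_append)
    next
      case False
      with \<open>y \<in> nodes\<close> have "length (y @ [True]) \<le> m^2" by (simp add: nodes_def)
      then show ?thesis by (rule less_imp_le[OF pos_less])
    qed
    then have "2 ^ pos (m^2) (y @ [True]) \<le> W"
      by (intro order.trans[OF power_increasing proc]) auto
    \<comment> \<open>Hence a terminal job at \<open>y\<close> blocks as well.\<close>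
    then have "test_size (m^2) y \<le> Suc W - 2 ^ pos (m^2) y"
      by (simp add: test_size_def)
    then have "measure_pmf.expectation (job inst (to_nat y)) (f (to_nat y)) =
        (1 - 1 / (real m)^2) * (1 - 1 / real m)"
      using \<open>y \<noteq> []\<close> \<open>y \<noteq> x\<close> m_pos test_size_pos[of "m^2" y]
      by (simp add: job_inst expectation_node_job f_def)
    also have "\<dots> \<le> 1 - 1 / real m" using p by (intro mult_left_le_one_le) auto
    finally show ?thesis .
  qed
  have "measure_pmf.expectation (realizations inst)
      (\<lambda>\<omega>. snd (\<omega> (to_nat x)) * (\<Prod>y\<in>Y. of_bool (fst (\<omega> (to_nat y)) < test_size (m^2) y))) =
    measure_pmf.expectation (realizations inst) (\<lambda>\<omega>. \<Prod>v\<in>to_nat ` insert x Y. f v (\<omega> v))"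
    using Y(2) by (intro arg_cong2[where f = measure_pmf.expectation] refl ext)
      (auto simp only: split f_def, auto intro!: prod.cong)
  also have "\<dots> = (\<Prod>v\<in>to_nat ` insert x Y. measure_pmf.expectation (job inst v) (f v))"
  proof -
    have "0 \<le> f (to_nat z) a" if "z \<in> insert x Y" "a \<in> set_pmf (job inst (to_nat z))" for z a
      using that x Y set_node_job[of m W z] by (auto simp: f_def job_inst)
    then show ?thesis
      unfolding realizations_def using x Y finite_nodes finite_set_job
      by (intro expectation_prod_Pi_pmf_subset) auto
  qed
  also have "\<dots> = 1 / (real m)^2 * (\<Prod>y\<in>Y. measure_pmf.expectation (job inst (to_nat y)) (f (to_nat y)))"
  proof -
    have "measure_pmf.expectation (job inst (to_nat x)) (f (to_nat x)) = 1 / (real m)^2"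
      using x m_pos by (simp add: job_inst expectation_node_job f_def)
    then show ?thesis by (simp only: split)
  qed
  also have "\<dots> \<le> 1 / (real m)^2 * (\<Prod>y\<in>Y. 1 - 1 / real m)"
    using p job Y(2) by (intro mult_left_mono prod_mono) (auto simp: f_def intro!: Bochner_Integration.integral_nonneg_AE AE_pmfI)
  finally show ?thesis by simp
qed

text \<open>All realizations visit initial segments of one chain. The path to its last node has at
  most \<open>m\<close> right turns, and \<open>1 / (1 - q) = m\<close> for
  \<open>q = 1 - 1/m\<close>, so the expected reward is at most
  \<open>(m + m) / m^2\<close>.\<close>

lemma expected_reward_nonadaptive_le:
  assumes "feasible_policy inst \<pi>" "nonadaptive \<pi>"
  shows "expected_reward inst \<pi> \<le> 2 / real m"
proof -
  obtain vs where vs: "\<And>\<omega>. prefix (visits \<pi> \<omega>) vs"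
    using assms(2) follows_prefix by (auto simp: nonadaptive_def)
  define supp where "supp = set_pmf (realizations inst)"
  have "finite supp" "supp \<noteq> {}"
    using finite_realizations by (auto simp: supp_def set_pmf_not_empty)
  \<comment> \<open>The fixed sequence may be infeasible beyond the stopping point, so the longest
    route visited with positive probability replaces it.\<close>
  then obtain \<omega>0 where w0: "\<omega>0 \<in> supp" "\<And>\<omega>. \<omega> \<in> supp \<Longrightarrow> length (visits \<pi> \<omega>) \<le> length (visits \<pi> \<omega>0)"
    using obtains_MAX[of supp "\<lambda>\<omega>. length (visits \<pi> \<omega>)"] Max_ge[of "(\<lambda>\<omega>. length (visits \<pi> \<omega>)) ` supp"]
    by (metis finite_imageI image_eqI)
  have "feasible_visits inst \<omega>0 (visits \<pi> \<omega>0)"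
    using assms(1) w0(1) by (simp add: feasible_policy_def supp_def)
  then obtain xs where xs: "visits \<pi> \<omega>0 = map to_nat xs" "set xs \<subseteq> nodes - {[]}"
    "sorted_wrt strict_prefix xs"
    by (rule feasible_visitsE)
  have take: "visits \<pi> \<omega> = take (length (visits \<pi> \<omega>)) (map to_nat xs)" if "\<omega> \<in> supp" for \<omega>
  proof -
    have "prefix (visits \<pi> \<omega>) (visits \<pi> \<omega>0)"
      using vs w0(2)[OF that] by (blast intro: prefix_length_prefix)
    then show ?thesis by (auto simp: xs(1)[symmetric] prefix_def)
  qed
  define L where "L = (\<lambda>x. {y \<in> set xs. prefix (y @ [False]) x})"
  let ?E = "measure_pmf.expectation (realizations inst)"
  let ?g = "\<lambda>x \<omega>. snd (\<omega> (to_nat x)) * (\<Prod>y\<in>L x. of_bool (fst (\<omega> (to_nat y)) < test_size (m^2) y))"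
  have "expected_reward inst \<pi> \<le> ?E (\<lambda>\<omega>. \<Sum>x\<in>set xs. ?g x \<omega>)"
    unfolding expected_reward_def
  proof (intro integral_mono_AE integrable_measure_pmf_finite finite_realizations AE_pmfI)
    fix \<omega> assume w: "\<omega> \<in> set_pmf (realizations inst)"
    then show "collected inst \<omega> (visits \<pi> \<omega>) \<le> (\<Sum>x\<in>set xs. ?g x \<omega>)"
      using take[of \<omega>] collected_chain_le[OF w xs(2,3), of "length (visits \<pi> \<omega>)"]
      by (simp add: supp_def L_def)
  qed
  also have "\<dots> = (\<Sum>x\<in>set xs. ?E (?g x))"
    by (intro Bochner_Integration.integral_sum integrable_measure_pmf_finite finite_realizations)
  also have "\<dots> \<le> (\<Sum>x\<in>set xs. 1 / (real m)^2 * (1 - 1 / real m) ^ card (L x))"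
    using xs(2) by (intro sum_mono expectation_unblocked_le) (auto simp: L_def dest: prefix_length_le)
  also have "\<dots> = 1 / (real m)^2 * (\<Sum>x\<in>set xs. (1 - 1 / real m) ^ card (L x))"
    by (simp add: sum_distrib_left)
  also have "\<dots> \<le> 1 / (real m)^2 * (2 * real m)"
  proof (intro mult_left_mono, cases "xs = []")
    case False
    define z where "z = last xs"
    have "prefix x z" if "x \<in> set xs" for x
    proof -
      obtain ys where "xs = ys @ [z]"
        using append_butlast_last_id[OF False, symmetric] by (auto simp: z_def)
      with xs(3) that show ?thesis by (auto simp: sorted_wrt_append strict_prefix_def)
    qed
    then have "(\<Sum>x\<in>set xs. (1 - 1 / real m) ^ card (L x)) \<le>
        real (count_list z True) + 1 / (1 - (1 - 1 / real m))"
      unfolding L_def using m_pos by (intro sum_power_left_turns_le) (auto simp: field_simps)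
    also have "count_list z True \<le> m"
      using xs(2) last_in_set[OF False] unfolding z_def nodes_def by blast
    finally show "(\<Sum>x\<in>set xs. (1 - 1 / real m) ^ card (L x)) \<le> 2 * real m" by simp
  qed simp_all
  also have "\<dots> = 2 / real m"
    using m_pos by (simp add: power2_eq_square)
  finally show ?thesis .
qed

section \<open>The two optima and their ratio\<close>

lemma opt_nonadaptive_le: "opt_nonadaptive inst \<le> 2 / real m"
proof -
  have "feasible_policy inst Stop" "nonadaptive Stop"
    by (auto simp: feasible_policy_def feasible_visits_def nonadaptive_def)
  then have "{\<pi>. feasible_policy inst \<pi> \<and> nonadaptive \<pi>} \<noteq> {}" by blast
  then show ?thesis
    unfolding opt_nonadaptive_def
    by (intro cSUP_least) (auto intro: expected_reward_nonadaptive_le)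
qed

text \<open>Guards the ratio against a zero denominator, for which division yields 0. Visiting only
  \<open>[False]\<close> earns \<open>1/m^2\<close>.\<close>

lemma opt_nonadaptive_pos: "0 < opt_nonadaptive inst"
proof -
  define \<pi> where "\<pi> = Visit (to_nat [False]) (\<lambda>_. Stop)"
  have node: "[False] \<in> nodes" using m_pos by (simp add: nodes_def)
  have "tour (m^2) B [] [[False]] \<le> B"
    using chain_imp_tour[OF travel, of "[]" "[[False]]"] m_pos by (force simp: tree_depth_def)
  then have "feasible_policy inst \<pi>"
    using node tour_eq[of "[]" "[[False]]"] by (auto simp: feasible_policy_def feasible_visits_def \<pi>_def)
  moreover have "nonadaptive \<pi>" by (auto simp: nonadaptive_def \<pi>_def)
  ultimately have "expected_reward inst \<pi> \<le> opt_nonadaptive inst"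
    unfolding opt_nonadaptive_def by (intro cSUP_upper bdd_above_expected_reward) auto
  moreover have "expected_reward inst \<pi> = 1 / (real m)^2"
    unfolding expected_reward_def collected_eq_gain
    using proc_pos by (subst expectation_resample[OF node]) (simp_all add: \<pi>_def cong: if_cong)
  ultimately show ?thesis using m_pos by (simp add: less_le_trans[rotated])
qed

lemma adaptivity_gap_ge: "ereal (real m / 6) \<le> adaptivity_gap B W"
proof -
  have "real m / 6 = (1 / 3) / (2 / real m)" by simp
  also have "\<dots> \<le> opt_adaptive inst / opt_nonadaptive inst"
    using opt_adaptive_ge opt_nonadaptive_le opt_nonadaptive_pos by (intro frac_le) auto
  finally have "ereal (real m / 6) \<le> ereal (opt_adaptive inst / opt_nonadaptive inst)" by simp
  then show ?thesis
    unfolding adaptivity_gap_def using corrko_instance_inst by (intro SUP_upper2[of inst]) auto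
qed

end

section \<open>Choosing the depth from a given budget\<close>

lemma nat_floor_sqrt_bounds:
  fixes t :: real
  assumes "1 \<le> t"
  defines "m \<equiv> nat \<lfloor>sqrt t\<rfloor>"
  shows "0 < m" "(real m)^2 \<le> t" "sqrt t \<le> 2 * real m"
proof -
  have 1: "1 \<le> sqrt t" using assms by simp
  then show "0 < m" by (simp add: m_def)
  have le: "real m \<le> sqrt t" using 1 by (simp add: m_def)
  then have "(real m)^2 \<le> (sqrt t)^2" by (intro power_mono) auto
  then show "(real m)^2 \<le> t" using assms by simp
  have "sqrt t < real m + 1" using 1 by (simp add: m_def)
  with \<open>0 < m\<close> show "sqrt t \<le> 2 * real m" by linarith
qed

theorem theorem1p1:
  "\<exists>c::real. c > 0 \<and>
     (\<exists>B0::nat. \<forall>B\<ge>B0. \<exists>W::nat. W \<ge> 2 \<and>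
        adaptivity_gap B W
          \<ge> ereal (c * max (sqrt (log 2 (real B))) (sqrt (log 2 (log 2 (real W)))))) \<and>
     (\<exists>W0::nat. \<forall>W\<ge>W0. \<exists>B::nat. B \<ge> 1 \<and>
        adaptivity_gap B W
          \<ge> ereal (c * max (sqrt (log 2 (real B))) (sqrt (log 2 (log 2 (real W))))))"
proof (rule exI[of _ "1 / 12"], intro conjI)
  \<comment> \<open>The constant \<open>1 / 12\<close> combines the gap \<open>m / 6\<close> with
    the factor 2 lost in rounding the square root to \<open>m\<close>.\<close>
  show "\<exists>B0::nat. \<forall>B\<ge>B0. \<exists>W::nat. W \<ge> 2 \<and> adaptivity_gap B W
      \<ge> ereal (1 / 12 * max (sqrt (log 2 (real B))) (sqrt (log 2 (log 2 (real W)))))"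
  proof (rule exI[of _ 2], intro allI impI)
    fix B :: nat assume B: "2 \<le> B"
    define t where "t = log 2 (real B)"
    have "1 \<le> t" using B by (simp add: t_def)
    define m where "m = nat \<lfloor>sqrt t\<rfloor>"
    note m = nat_floor_sqrt_bounds[OF \<open>1 \<le> t\<close>, folded m_def]
    have "(2::real) ^ m^2 \<le> real B"
      using m(2) B by (simp add: t_def le_log_iff powr_realpow[symmetric])
    then have "2 ^ m^2 \<le> B" by (metis of_nat_le_iff of_nat_numeral of_nat_power)
    \<comment> \<open>The least \<open>W\<close> permitted by \<open>proc\<close>; then
      \<open>log 2 (log 2 W) = m^2\<close>, at most \<open>log 2 B\<close>.\<close>
    then interpret gap_instance m B "2 ^ 2 ^ m^2" using m(1) by unfold_locales auto
    have W: "log 2 (log 2 (real (2 ^ 2 ^ m^2))) = (real m)^2" by simp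
    have "1 / 12 * max (sqrt (log 2 (real B))) (sqrt (log 2 (log 2 (real (2 ^ 2 ^ m^2))))) \<le> real m / 6"
      using m(3) unfolding W by (auto simp: t_def max_def)
    then have "ereal (1 / 12 * max (sqrt (log 2 (real B))) (sqrt (log 2 (log 2 (real (2 ^ 2 ^ m^2))))))
        \<le> adaptivity_gap B (2 ^ 2 ^ m^2)"
      by (intro order.trans[OF _ adaptivity_gap_ge]) (simp only: ereal_less_eq)
    moreover have "(2::nat) \<le> 2 ^ 2 ^ m^2"
      by (rule self_le_power) auto
    ultimately show "\<exists>W::nat. W \<ge> 2 \<and> adaptivity_gap B W
        \<ge> ereal (1 / 12 * max (sqrt (log 2 (real B))) (sqrt (log 2 (log 2 (real W)))))"
      by blast
  qed
  show "\<exists>W0::nat. \<forall>W\<ge>W0. \<exists>B::nat. B \<ge> 1 \<and> adaptivity_gap B W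
      \<ge> ereal (1 / 12 * max (sqrt (log 2 (real B))) (sqrt (log 2 (log 2 (real W)))))"
  proof (rule exI[of _ 4], intro allI impI)
    fix W :: nat assume W: "4 \<le> W"
    define t where "t = log 2 (log 2 (real W))"
    have "log 2 4 \<le> log 2 (real W)" using W by simp
    moreover have "log 2 4 = (2::real)" using log_pow_cancel[of 2 2] by simp
    ultimately have log: "2 \<le> log 2 (real W)" by simp
    then have "1 \<le> t" by (simp add: t_def)
    define m where "m = nat \<lfloor>sqrt t\<rfloor>"
    note m = nat_floor_sqrt_bounds[OF \<open>1 \<le> t\<close>, folded m_def]
    have "(2::real) ^ m^2 \<le> log 2 (real W)"
      using m(2) log by (simp add: t_def le_log_iff powr_realpow[symmetric])
    then have "real (2 ^ m^2) \<le> log 2 (real W)" by simp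
    then have "2 powr real (2 ^ m^2) \<le> real W" using W by (subst (asm) le_log_iff) auto
    then have "(2::real) ^ 2 ^ m^2 \<le> real W" by (subst (asm) powr_realpow) auto
    then have "2 ^ 2 ^ m^2 \<le> W" by (metis of_nat_le_iff of_nat_numeral of_nat_power)
    \<comment> \<open>Here \<open>B\<close> is chosen so that \<open>log 2 B = m^2\<close>, at most
      \<open>log 2 (log 2 W)\<close>.\<close>
    then interpret gap_instance m "2 ^ m^2" W using m(1) by unfold_locales auto
    have B: "log 2 (real (2 ^ m^2)) = (real m)^2" by simp
    have "1 / 12 * max (sqrt (log 2 (real (2 ^ m^2)))) (sqrt (log 2 (log 2 (real W)))) \<le> real m / 6"
      using m(3) unfolding B by (auto simp: t_def max_def)
    then have "ereal (1 / 12 * max (sqrt (log 2 (real (2 ^ m^2)))) (sqrt (log 2 (log 2 (real W)))))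
        \<le> adaptivity_gap (2 ^ m^2) W"
      by (intro order.trans[OF _ adaptivity_gap_ge]) (simp only: ereal_less_eq)
    then show "\<exists>B::nat. B \<ge> 1 \<and> adaptivity_gap B W
        \<ge> ereal (1 / 12 * max (sqrt (log 2 (real B))) (sqrt (log 2 (log 2 (real W)))))"
      using travel_pos by (intro exI[of _ "2 ^ m^2"] conjI) simp_all
  qed
qed simp

end
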